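(* There is an absolute constant $c>0$ such that for every integer $n\geq 2$ and every $\varepsilon>\frac{1}{n}$, there exists a graph $G$ with $n$ vertices such that every $\varepsilon$-resistance sparsifier of $G$ has at least $c\, n/\sqrt{\varepsilon}$ edges (i.e. $\Omega(n/\sqrt{\varepsilon})$ edges).
   Context: Graphs are weighted undirected graphs $G=(V,E,w)$ with positive edge weights. The effective resistance between $s,t\in V$ is $R_{\mathrm{eff},G}(s,t)=\min\{\sum_{e\in E} f(e)^2/w(e) : f \text{ is a flow shipping one unit from } s \text{ to } t\}$ (infinite if no such flow exists). Given a graph $G=(V,E,w)$ and $\varepsilon>0$, an $\varepsilon$-resistance sparsifier of $G$ is any graph $G'=(V,E',w')$ on the same vertex set (not necessarily a subgraph of $G$, arbitrary positive weights allowed) such that $R_{\mathrm{eff},G'}(x,y)\in[(1-\varepsilon)R_{\mathrm{eff},G}(x,y),(1+\varepsilon)R_{\mathrm{eff},G}(x,y)]$ for all $x,y\in V$. *)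

theory Defs
  imports Complex_Main "HOL-Library.Extended_Real"
begin

record 'a wgraph =
  verts :: "'a set"
  edges :: "'a set set"
  weight :: "'a set \<Rightarrow> real"

text \<open>Finite simple undirected graphs (no loops, no parallel edges) with positive edge weights.
  Values of the weight function outside the edge set are irrelevant.\<close>

definition weighted_graph :: "'a wgraph \<Rightarrow> bool" where
  "weighted_graph G \<longleftrightarrow>
     finite (verts G) \<and>
     (\<forall>e\<in>edges G. e \<subseteq> verts G \<and> card e = 2) \<and>
     (\<forall>e\<in>edges G. weight G e > 0)"

text \<open>A flow is given orientation-free, as an antisymmetric function supported on the edges:
  \<open>f u v\<close> is the signed amount sent from \<open>u\<close> to \<open>v\<close> along the edge \<open>{u, v}\<close>.
  The net outflow is 1 at \<open>s\<close>, -1 at \<open>t\<close> and 0 elsewhere; for \<open>s = t\<close> it is 0 everywhere.\<close>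

definition unit_flow :: "'a wgraph \<Rightarrow> 'a \<Rightarrow> 'a \<Rightarrow> ('a \<Rightarrow> 'a \<Rightarrow> real) \<Rightarrow> bool" where
  "unit_flow G s t f \<longleftrightarrow>
     (\<forall>u v. f v u = - f u v) \<and>
     (\<forall>u v. {u, v} \<notin> edges G \<longrightarrow> f u v = 0) \<and>
     (\<forall>v\<in>verts G. (\<Sum>u\<in>verts G. f v u) = of_bool (v = s) - of_bool (v = t))"

text \<open>The sum of \<open>f(e)\<^sup>2 / w(e)\<close> over all edges \<open>e\<close>: the sum below runs over ordered pairs and so
  meets every edge exactly twice, with the same term both times.\<close>

definition flow_energy :: "'a wgraph \<Rightarrow> ('a \<Rightarrow> 'a \<Rightarrow> real) \<Rightarrow> real" where
  "flow_energy G f = (\<Sum>(u, v)\<in>{(u, v). {u, v} \<in> edges G}. (f u v)\<^sup>2 / weight G {u, v}) / 2"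

text \<open>If a unit flow exists then the infimum is attained (a positive definite quadratic form on a
  nonempty affine subspace of a finite-dimensional space), so it is the minimum; otherwise it is
  \<open>\<infinity>\<close>, the infimum of the empty set.\<close>

definition eff_resistance :: "'a wgraph \<Rightarrow> 'a \<Rightarrow> 'a \<Rightarrow> ereal" where
  "eff_resistance G s t = (INF f\<in>{f. unit_flow G s t f}. ereal (flow_energy G f))"

text \<open>Arithmetic is that of \<^typ>\<open>ereal\<close>: when \<open>R(x, y) = \<infinity>\<close> in \<open>G\<close> and \<open>\<epsilon> < 1\<close>, both bounds are
  \<open>\<infinity>\<close>, so \<open>x\<close> and \<open>y\<close> must be disconnected in \<open>H\<close> too; when \<open>\<epsilon> \<ge> 1\<close> the lower bound is \<open>\<le> 0\<close>
  (using \<open>0 * \<infinity> = 0\<close>) and imposes nothing.\<close>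

definition resistance_sparsifier :: "real \<Rightarrow> 'a wgraph \<Rightarrow> 'a wgraph \<Rightarrow> bool" where
  "resistance_sparsifier \<epsilon> G H \<longleftrightarrow>
     weighted_graph H \<and> verts H = verts G \<and>
     (\<forall>x\<in>verts G. \<forall>y\<in>verts G.
        eff_resistance H x y \<in>
          {ereal (1 - \<epsilon>) * eff_resistance G x y .. ereal (1 + \<epsilon>) * eff_resistance G x y})"

end

theory Submission
  imports Defs "Jordan_Normal_Form.Determinant"
begin

text \<open>The hard graph is a disjoint union of cliques of size \<open>k\<close>, with \<open>k\<close> about \<open>1 / (2 sqrt \<epsilon>)\<close>; a
  sparsifier \<open>H\<close> has to contain every edge of every clique. Let \<open>w\<close> and \<open>d\<close> be the edge weights and
  weighted degrees of \<open>H\<close> on one clique, where all resistances lie in \<open>(1 \<plusminus> \<epsilon>) 2/k\<close>. The potential that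
  is \<open>1\<close> at \<open>x\<close>, \<open>-1\<close> at \<open>y\<close> and \<open>0\<close> elsewhere gives \<open>4 / R(x, y) \<le> 2 w(x, y) + d(x) + d(y)\<close>, and
  Foster's theorem bounds the total weight by \<open>\<Sum>\<^sub>x d(x) \<le> k (k - 1) / (1 - \<epsilon>)\<close>. Summing the first
  inequality over \<open>y\<close> yields \<open>d(x) \<ge> (k - 1)(1 - 4 \<epsilon>)\<close> for every \<open>x\<close>, so by the second no two degrees
  sum to much more than \<open>2 (k - 1)\<close>; a pair with \<open>w(x, y) = 0\<close> would need almost \<open>2 k\<close>.
  For \<open>\<epsilon> > 1/16\<close> a single clique suffices, as \<open>H\<close> then has no isolated vertex.\<close>

section \<open>Solving Laplacian systems\<close>

text \<open>A square matrix with trivial kernel has nonzero determinant and hence an inverse. The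
  bijection \<open>h\<close> between \<open>{0..<n}\<close> and \<open>C\<close> carries this fact
  about indexed matrices over to systems indexed by an arbitrary finite set.\<close>

lemma linear_system_solvable:
  fixes A :: "'a \<Rightarrow> 'a \<Rightarrow> real"
  assumes fin: "finite C"
    and inj: "\<And>g v. \<lbrakk>\<forall>v\<in>C. (\<Sum>u\<in>C. A v u * g u) = 0; v \<in> C\<rbrakk> \<Longrightarrow> g v = 0"
  shows "\<exists>g. \<forall>v\<in>C. (\<Sum>u\<in>C. A v u * g u) = b v"
proof -
  define n where "n = card C"
  obtain h where h: "bij_betw h {0..<n} C"
    using ex_bij_betw_nat_finite[OF fin] unfolding n_def by blast
  define M where "M = mat n n (\<lambda>(i, j). A (h i) (h j))"
  define k where "k = inv_into {0..<n} h"
  have kh: "k (h i) = i" if "i < n" for i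
    using bij_betw_inv_into_left[OF h] that unfolding k_def by simp
  have hC: "h i \<in> C" if "i < n" for i
    using bij_betwE[OF h] that by simp
  have Ch: "\<exists>i<n. v = h i" if "v \<in> C" for v
    using h that unfolding bij_betw_def by (auto simp: image_iff)
  have M: "M \<in> carrier_mat n n"
    unfolding M_def by simp
  have entry: "(M *\<^sub>v x) $ i = (\<Sum>u\<in>C. A (h i) u * x $ k u)"
    if "x \<in> carrier_vec n" "i < n" for x i
  proof -
    have "(\<Sum>u\<in>C. A (h i) u * x $ k u) = (\<Sum>j\<in>{0..<n}. A (h i) (h j) * x $ k (h j))"
      by (rule sum.reindex_bij_betw[OF h, symmetric])
    also have "\<dots> = (\<Sum>j\<in>{0..<n}. A (h i) (h j) * x $ j)"
      by (rule sum.cong) (auto simp: kh)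
    finally show ?thesis
      using that by (simp add: M_def scalar_prod_def)
  qed
  have "det M \<noteq> 0"
  proof
    assume "det M = 0"
    then obtain x where x: "x \<in> carrier_vec n" "x \<noteq> 0\<^sub>v n" "M *\<^sub>v x = 0\<^sub>v n"
      using det_0_iff_vec_prod_zero_field[OF M] by blast
    have "(\<Sum>u\<in>C. A v u * x $ k u) = 0" if v: "v \<in> C" for v
    proof -
      obtain i where "i < n" "v = h i"
        using Ch[OF v] by blast
      then show ?thesis
        using entry[OF x(1), of i] x(3) by simp
    qed
    then have "x $ k v = 0" if "v \<in> C" for v
      using inj[of "\<lambda>u. x $ k u"] that by blast
    then have "x $ i = 0" if "i < n" for i
      using kh hC that by metis
    then have "x = 0\<^sub>v n"
      using x(1) by (intro eq_vecI) auto
    with x(2) show False ..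
  qed
  from det_non_zero_imp_unit[OF M this, of "()"]
  obtain B where B: "B \<in> carrier_mat n n" "M * B = 1\<^sub>m n"
    unfolding Units_def ring_mat_def by auto
  define x where "x = B *\<^sub>v vec n (\<lambda>i. b (h i))"
  have x: "x \<in> carrier_vec n"
    using B(1) unfolding x_def by simp
  have Mx: "M *\<^sub>v x = vec n (\<lambda>i. b (h i))"
    using assoc_mult_mat_vec[OF M B(1), of "vec n (\<lambda>i. b (h i))"] B(2) unfolding x_def by simp
  have "(\<Sum>u\<in>C. A v u * x $ k u) = b v" if v: "v \<in> C" for v
  proof -
    obtain i where "i < n" "v = h i"
      using Ch[OF v] by blast
    then show ?thesis
      using entry[OF x, of i] Mx by simp
  qed
  then show ?thesis by (intro exI[of _ "\<lambda>u. x $ k u"] ballI)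
qed

text \<open>Summation by parts: exchanging \<open>u\<close> and \<open>v\<close> turns the terms
  with \<open>p u\<close> into the negatives of those with \<open>p v\<close>, so both halves of the
  double sum agree. With \<open>p = g\<close> it gives the Dirichlet energy, with
  \<open>p = 1\<close> the vanishing total of a Laplacian image.\<close>

lemma sum_laplacian_mult:
  fixes W :: "'a \<Rightarrow> 'a \<Rightarrow> real"
  assumes sym: "\<And>u v. W u v = W v u"
  shows "(\<Sum>v\<in>C. (\<Sum>u\<in>C. W v u * (g v - g u)) * p v)
       = (\<Sum>v\<in>C. \<Sum>u\<in>C. W v u * (g v - g u) * (p v - p u)) / 2"
proof -
  let ?S = "\<Sum>v\<in>C. \<Sum>u\<in>C. W v u * (g v - g u) * p v"
  have "(\<Sum>v\<in>C. \<Sum>u\<in>C. W v u * (g v - g u) * p u)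
      = (\<Sum>v\<in>C. \<Sum>u\<in>C. W u v * (g u - g v) * p v)"
    by (rule sum.swap)
  also have "\<dots> = - ?S"
    by (simp add: sum_negf[symmetric] sym algebra_simps)
  finally have neg: "(\<Sum>v\<in>C. \<Sum>u\<in>C. W v u * (g v - g u) * p u) = - ?S" .
  have "(\<Sum>v\<in>C. \<Sum>u\<in>C. W v u * (g v - g u) * (p v - p u)) = 2 * ?S"
    unfolding right_diff_distrib[of "_ * _"] sum_subtractf neg by simp
  then show ?thesis
    by (simp add: sum_distrib_right)
qed

text \<open>The hypothesis \<open>conn\<close> expresses connectedness of \<open>C\<close>: a
  function that is constant along edges is constant. The kernel of the Laplacian then consists of
  constants, and adding the all-ones matrix makes it injective. For a right-hand side of total 0 the
  added term vanishes on the solution, which thus solves the original system.\<close>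

lemma laplacian_solvable:
  fixes W :: "'a \<Rightarrow> 'a \<Rightarrow> real"
  assumes fin: "finite C"
    and sym: "\<And>u v. W u v = W v u"
    and nonneg: "\<And>u v. W u v \<ge> 0"
    and conn: "\<And>g u v. \<lbrakk>\<forall>u\<in>C. \<forall>v\<in>C. W u v \<noteq> 0 \<longrightarrow> g u = g v; u \<in> C; v \<in> C\<rbrakk>
                \<Longrightarrow> g u = (g v :: real)"
    and b0: "(\<Sum>v\<in>C. b v) = 0"
  shows "\<exists>g. \<forall>v\<in>C. (\<Sum>u\<in>C. W v u * (g v - g u)) = b v"
proof -
  define d where "d v = (\<Sum>u\<in>C. W v u)" for v
  define A where "A v u = (if u = v then d v else 0) - W v u + 1" for v u
  have A: "(\<Sum>u\<in>C. A v u * g u) = (\<Sum>u\<in>C. W v u * (g v - g u)) + (\<Sum>u\<in>C. g u)"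
    if "v \<in> C" for v g
  proof -
    have "(\<Sum>u\<in>C. A v u * g u)
        = (\<Sum>u\<in>C. (if u = v then d v * g u else 0)) - (\<Sum>u\<in>C. W v u * g u) + (\<Sum>u\<in>C. g u)"
      unfolding A_def sum_subtractf[symmetric] sum.distrib[symmetric]
      by (intro sum.cong) (auto simp: algebra_simps)
    also have "(\<Sum>u\<in>C. (if u = v then d v * g u else 0)) = d v * g v"
      using that fin by (simp add: sum.delta)
    finally show ?thesis
      by (simp add: d_def sum_distrib_right right_diff_distrib sum_subtractf)
  qed
  have total: "(\<Sum>v\<in>C. \<Sum>u\<in>C. W v u * (g v - g u)) = 0" for g
    using sum_laplacian_mult[where W = W, OF sym, where g = g and p = "\<lambda>_. 1" and C = C] by simp
  \<comment> \<open>Adding up all rows cancels the Laplacian part and leaves \<open>card C\<close>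
    copies of the sum of \<open>g\<close>.\<close>
  have zero: "(\<Sum>u\<in>C. g u) = 0" if "\<forall>v\<in>C. (\<Sum>u\<in>C. A v u * g u) = r v" "(\<Sum>v\<in>C. r v) = 0" for g r
  proof -
    have "0 = (\<Sum>v\<in>C. \<Sum>u\<in>C. A v u * g u)"
      using that by simp
    also have "\<dots> = (\<Sum>v\<in>C. (\<Sum>u\<in>C. W v u * (g v - g u)) + (\<Sum>u\<in>C. g u))"
      by (rule sum.cong) (simp_all add: A)
    also have "\<dots> = card C * (\<Sum>u\<in>C. g u)"
      by (simp add: sum.distrib total)
    finally have "card C = 0 \<or> (\<Sum>u\<in>C. g u) = 0" by simp
    then show ?thesis using fin by auto
  qed
  have "\<exists>g. \<forall>v\<in>C. (\<Sum>u\<in>C. A v u * g u) = b v"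
  proof (rule linear_system_solvable[OF fin])
    fix g v assume g: "\<forall>v\<in>C. (\<Sum>u\<in>C. A v u * g u) = 0" and v: "v \<in> C"
    have s0: "(\<Sum>u\<in>C. g u) = 0"
      using zero[of g "\<lambda>_. 0"] g by simp
    then have "(\<Sum>u\<in>C. W v u * (g v - g u)) = 0" if "v \<in> C" for v
      using g A[OF that, of g] that by simp
    then have "(\<Sum>v\<in>C. \<Sum>u\<in>C. W v u * (g v - g u) * (g v - g u)) = 0"
      using sum_laplacian_mult[where W = W, OF sym, where g = g and p = g and C = C] by simp
    then have "W v u * (g v - g u) * (g v - g u) = 0" if "v \<in> C" "u \<in> C" for u v
      using that fin nonneg
      by (simp add: sum_nonneg_eq_0_iff sum_nonneg mult.assoc)
    then have eq: "g u = g v" if "u \<in> C" for u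
      using conn[of g u v] that v by auto
    have "card C * g v = 0"
      using s0 eq by simp
    then show "g v = 0"
      using v fin by auto
  qed
  then obtain g where g: "\<forall>v\<in>C. (\<Sum>u\<in>C. A v u * g u) = b v" by blast
  have "(\<Sum>u\<in>C. W v u * (g v - g u)) = b v" if "v \<in> C" for v
    using A[OF that, of g] zero[OF g b0] g that by simp
  then show ?thesis by blast
qed

section \<open>Flows, potentials and bounds on effective resistance\<close>

text \<open>Extending the weights by 0 off the edge set lets degrees and energies be sums over all
  pairs of vertices.\<close>

definition conductance :: "'a wgraph \<Rightarrow> 'a \<Rightarrow> 'a \<Rightarrow> real" where
  "conductance G u v = (if {u, v} \<in> edges G then weight G {u, v} else 0)"

lemma conductance_sym: "conductance G u v = conductance G v u"
  by (simp add: conductance_def insert_commute)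

lemma conductance_nonneg: "weighted_graph G \<Longrightarrow> conductance G u v \<ge> 0"
  by (simp add: conductance_def weighted_graph_def order_less_imp_le)

lemma conductance_eq_0_iff:
  "weighted_graph G \<Longrightarrow> conductance G u v = 0 \<longleftrightarrow> {u, v} \<notin> edges G"
  by (auto simp: conductance_def weighted_graph_def)

lemma conductance_self: "weighted_graph G \<Longrightarrow> conductance G u u = 0"
  by (auto simp: conductance_def weighted_graph_def)

text \<open>Pairs that are not edges have conductance 0 and contribute 0, since division by zero
  yields 0.\<close>

lemma flow_energy_eq:
  assumes G: "weighted_graph G"
  shows "flow_energy G f = (\<Sum>u\<in>verts G. \<Sum>v\<in>verts G. (f u v)\<^sup>2 / conductance G u v) / 2"
proof -
  have fin: "finite (verts G)" using G by (simp add: weighted_graph_def)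
  have "(\<Sum>(u, v)\<in>{(u, v). {u, v} \<in> edges G}. (f u v)\<^sup>2 / weight G {u, v})
      = (\<Sum>(u, v)\<in>verts G \<times> verts G. (f u v)\<^sup>2 / conductance G u v)"
    using G fin
    by (intro sum.mono_neutral_cong_left) (auto simp: conductance_def weighted_graph_def split: if_splits)
  then show ?thesis
    by (simp add: flow_energy_def sum.cartesian_product)
qed

lemma unit_flow_non_edge: "\<lbrakk>unit_flow G s t f; {u, v} \<notin> edges G\<rbrakk> \<Longrightarrow> f u v = 0"
  unfolding unit_flow_def by blast

text \<open>Weighting the net outflow at each vertex by \<open>p\<close> gives
  \<open>p s - p t\<close>. Antisymmetry of \<open>f\<close> rewrites the same sum through potential
  differences, with every edge met twice.\<close>

lemma unit_flow_potential:
  assumes f: "unit_flow G s t f" and fin: "finite (verts G)"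
    and st: "s \<in> verts G" "t \<in> verts G"
  shows "p s - p t = (\<Sum>u\<in>verts G. \<Sum>v\<in>verts G. f u v * (p u - p v)) / 2"
proof -
  let ?V = "verts G"
  have anti: "f v u = - f u v" for u v
    using f unfolding unit_flow_def by blast
  have "(\<Sum>u\<in>?V. \<Sum>v\<in>?V. f u v * p v) = (\<Sum>v\<in>?V. \<Sum>u\<in>?V. f u v * p v)"
    by (rule sum.swap)
  also have "\<dots> = (\<Sum>v\<in>?V. \<Sum>u\<in>?V. - (f v u * p v))"
    by (intro sum.cong refl) (metis anti mult_minus_left)
  finally have "(\<Sum>u\<in>?V. \<Sum>v\<in>?V. f u v * (p u - p v)) / 2 = (\<Sum>u\<in>?V. (\<Sum>v\<in>?V. f u v) * p u)"
    by (simp add: right_diff_distrib sum_subtractf sum_negf sum_distrib_right)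
  also have "\<dots> = (\<Sum>u\<in>?V. (of_bool (u = s) - of_bool (u = t)) * p u)"
  proof (intro sum.cong refl)
    fix u assume "u \<in> ?V"
    then have "(\<Sum>v\<in>?V. f u v) = of_bool (u = s) - of_bool (u = t)"
      using f unfolding unit_flow_def by blast
    then show "(\<Sum>v\<in>?V. f u v) * p u = (of_bool (u = s) - of_bool (u = t)) * p u" by simp
  qed
  also have "\<dots> = p s - p t"
    using fin st by (simp add: left_diff_distrib sum_subtractf of_bool_def if_distrib[of "\<lambda>x. x * _"]
        cong: if_cong)
  finally show ?thesis by simp
qed

text \<open>The dual bound on the energy: per edge, expand the nonnegative term
  \<open>(f - a * W * (p u - p v))^2 / W\<close>, where \<open>W\<close> is the conductance, and
  sum. The scale \<open>a\<close> stays free so that it can be optimised later, also when the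
  potential has zero energy.\<close>

lemma eff_resistance_ge:
  assumes G: "weighted_graph G" and st: "s \<in> verts G" "t \<in> verts G"
  shows "eff_resistance G s t \<ge> ereal (2 * a * (p s - p t)
           - a\<^sup>2 * ((\<Sum>u\<in>verts G. \<Sum>v\<in>verts G. conductance G u v * (p u - p v)\<^sup>2) / 2))"
  unfolding eff_resistance_def
proof (rule INF_greatest)
  fix f assume "f \<in> {f. unit_flow G s t f}"
  then have f: "unit_flow G s t f" by simp
  let ?V = "verts G" and ?W = "conductance G"
  have fin: "finite ?V" using G by (simp add: weighted_graph_def)
  have pw: "2 * a * (f u v * (p u - p v)) - a\<^sup>2 * (?W u v * (p u - p v)\<^sup>2) \<le> (f u v)\<^sup>2 / ?W u v" for u v
  proof (cases "?W u v = 0")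
    case True
    then have "f u v = 0"
      using unit_flow_non_edge[OF f] conductance_eq_0_iff[OF G] by blast
    with True show ?thesis by simp
  next
    case False
    then have w: "?W u v > 0" using conductance_nonneg[OF G, of u v] by simp
    have "0 \<le> (f u v - a * ?W u v * (p u - p v))\<^sup>2 / ?W u v"
      using w by simp
    also have "\<dots> = (f u v)\<^sup>2 / ?W u v - 2 * a * (f u v * (p u - p v)) + a\<^sup>2 * (?W u v * (p u - p v)\<^sup>2)"
      using w by (simp add: field_simps power2_eq_square)
    finally show ?thesis by simp
  qed
  have "2 * a * (p s - p t) - a\<^sup>2 * ((\<Sum>u\<in>?V. \<Sum>v\<in>?V. ?W u v * (p u - p v)\<^sup>2) / 2)
      = (\<Sum>u\<in>?V. \<Sum>v\<in>?V. 2 * a * (f u v * (p u - p v)) - a\<^sup>2 * (?W u v * (p u - p v)\<^sup>2)) / 2"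
    unfolding unit_flow_potential[OF f fin st, of p]
    by (simp add: sum_subtractf sum_distrib_left[symmetric] diff_divide_distrib)
  also have "\<dots> \<le> flow_energy G f"
    unfolding flow_energy_eq[OF G] by (intro divide_right_mono sum_mono pw) simp
  finally show "ereal (2 * a * (p s - p t) - a\<^sup>2 * ((\<Sum>u\<in>?V. \<Sum>v\<in>?V. ?W u v * (p u - p v)\<^sup>2) / 2))
      \<le> ereal (flow_energy G f)" by simp
qed

text \<open>The potential that is 1 at \<open>s\<close>, -1 at \<open>t\<close> and 0 elsewhere has
  Dirichlet energy exactly \<open>D\<close>.\<close>

lemma eff_resistance_ge_degrees:
  assumes G: "weighted_graph G" and st: "s \<in> verts G" "t \<in> verts G" "s \<noteq> t"
    and D: "D = 2 * conductance G s t + (\<Sum>v\<in>verts G. conductance G s v)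
                + (\<Sum>v\<in>verts G. conductance G t v)"
    and r: "eff_resistance G s t \<le> ereal r"
  shows "4 \<le> r * D"
proof -
  let ?V = "verts G" and ?W = "conductance G"
  have fin: "finite ?V" using G by (simp add: weighted_graph_def)
  define p :: "'a \<Rightarrow> real" where "p u = of_bool (u = s) - of_bool (u = t)" for u
  have row: "(\<Sum>v\<in>?V. ?W u v * (p u - p v) * p u)
       = (if u = s then (\<Sum>v\<in>?V. ?W s v) + ?W s t else 0)
       + (if u = t then (\<Sum>v\<in>?V. ?W t v) + ?W s t else 0)" for u
  proof -
    have aux: "(\<Sum>v\<in>?V. ?W u v * p v) = ?W u s - ?W u t"
      using fin st by (simp add: p_def right_diff_distrib sum_subtractf of_bool_def
          if_distrib[of "\<lambda>x. _ * x"] cong: if_cong)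
    have "(\<Sum>v\<in>?V. ?W u v * (p u - p v) * p u)
        = ((\<Sum>v\<in>?V. ?W u v) * p u - (\<Sum>v\<in>?V. ?W u v * p v)) * p u"
      by (simp add: right_diff_distrib sum_subtractf sum_distrib_right left_diff_distrib)
    then show ?thesis
      using st(3) conductance_self[OF G] conductance_sym[of G s t] unfolding aux
      by (simp add: p_def)
  qed
  have "(\<Sum>u\<in>?V. \<Sum>v\<in>?V. ?W u v * (p u - p v)\<^sup>2) / 2
      = (\<Sum>u\<in>?V. \<Sum>v\<in>?V. ?W u v * (p u - p v) * p u)"
    using sum_laplacian_mult[where W = ?W and g = p and p = p and C = ?V] conductance_sym[of G]
    by (simp add: power2_eq_square sum_distrib_right mult.assoc)
  also have "\<dots> = D"
    unfolding row D using fin st by (simp add: sum.distrib)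
  finally have E: "(\<Sum>u\<in>?V. \<Sum>v\<in>?V. ?W u v * (p u - p v)\<^sup>2) / 2 = D" .
  have le: "4 * a - a\<^sup>2 * D \<le> r" for a
    using order_trans[OF eff_resistance_ge[OF G st(1,2), of a p] r] st(3) unfolding E
    by (simp add: p_def)
  have "D \<ge> 0"
    unfolding D using conductance_nonneg[OF G] by (intro add_nonneg_nonneg sum_nonneg) auto
  \<comment> \<open>For \<open>D = 0\<close> the bound \<open>4 * a \<le> r\<close> would hold for
    every \<open>a\<close>.\<close>
  moreover have "D \<noteq> 0"
    using le[of "\<bar>r\<bar> + 1"] by auto
  ultimately have "D > 0" by simp
  then show ?thesis
    \<comment> \<open>The value \<open>2 / D\<close> maximises \<open>4 * a - a^2 * D\<close>, with
      maximum \<open>4 / D\<close>.\<close>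
    using le[of "2 / D"] by (simp add: field_simps power2_eq_square)
qed

text \<open>Ohm's law: the flow given by conductance times potential difference inside
  \<open>C\<close>, and zero on all other pairs, ships one unit from \<open>s\<close> to
  \<open>t\<close>. Pairing it with its own potential shows that its energy is the drop
  \<open>p s - p t\<close>.\<close>

lemma eff_resistance_le_potential:
  assumes G: "weighted_graph G" and C: "C \<subseteq> verts G" and st: "s \<in> C" "t \<in> C"
    and p: "\<And>v. v \<in> C \<Longrightarrow>
      (\<Sum>u\<in>C. conductance G v u * (p v - p u)) = of_bool (v = s) - of_bool (v = t)"
  shows "eff_resistance G s t \<le> ereal (p s - p t)"
proof -
  let ?V = "verts G" and ?W = "conductance G"
  have fin: "finite ?V" using G by (simp add: weighted_graph_def)
  define f where "f u v = (if u \<in> C \<and> v \<in> C then ?W u v * (p u - p v) else 0)" for u v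
  have out: "(\<Sum>u\<in>?V. f v u) = of_bool (v = s) - of_bool (v = t)" for v
  proof (cases "v \<in> C")
    case True
    have "(\<Sum>u\<in>?V. f v u) = (\<Sum>u\<in>C. ?W v u * (p v - p u))"
      using fin C True by (intro sum.mono_neutral_cong_right) (auto simp: f_def)
    with p[OF True] show ?thesis by simp
  next
    case False
    then show ?thesis using st by (auto simp: f_def)
  qed
  have f: "unit_flow G s t f"
    unfolding unit_flow_def
  proof (intro conjI allI impI ballI)
    show "f v u = - f u v" for u v
      using conductance_sym[of G u v] by (simp add: f_def algebra_simps)
    show "f u v = 0" if "{u, v} \<notin> edges G" for u v
      using that by (simp add: f_def conductance_def)
  qed (rule out)
  have "flow_energy G f = (\<Sum>u\<in>?V. \<Sum>v\<in>?V. f u v * (p u - p v)) / 2"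
    unfolding flow_energy_eq[OF G]
    by (intro arg_cong[of _ _ "\<lambda>x. x / 2"] sum.cong refl)
       (auto simp: f_def power2_eq_square divide_simps)
  also have "\<dots> = p s - p t"
    using unit_flow_potential[OF f fin, of p] st C by (simp add: subset_iff)
  finally show ?thesis
    unfolding eff_resistance_def using f by (metis INF_lower mem_Collect_eq)
qed

lemma eff_resistance_no_flow:
  assumes "\<And>f. \<not> unit_flow G s t f"
  shows "eff_resistance G s t = \<infinity>"
proof -
  have "{f. unit_flow G s t f} = {}" using assms by blast
  then show ?thesis
    unfolding eff_resistance_def by (simp only: image_empty Inf_empty top_ereal_def)
qed

section \<open>Separated vertex sets and Foster's theorem\<close>

definition separated :: "'a wgraph \<Rightarrow> 'a set \<Rightarrow> bool" where
  "separated G C \<longleftrightarrow> (\<forall>u\<in>C. \<forall>v\<in>verts G - C. {u, v} \<notin> edges G)"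

text \<open>The indicator of \<open>C\<close> is constant along edges, so pairing it with a flow
  gives 0, whereas a unit flow from \<open>s\<close> to \<open>t\<close> would give 1.\<close>

lemma eff_resistance_separated:
  assumes G: "weighted_graph G" and C: "separated G C"
    and s: "s \<in> verts G" "s \<in> C" and t: "t \<in> verts G" "t \<notin> C"
  shows "eff_resistance G s t = \<infinity>"
proof -
  have "\<not> unit_flow G s t f" for f
  proof
    assume f: "unit_flow G s t f"
    let ?V = "verts G" and ?p = "\<lambda>u. of_bool (u \<in> C) :: real"
    have "f u v * (?p u - ?p v) = 0" if "u \<in> ?V" "v \<in> ?V" for u v
    proof (cases "u \<in> C \<longleftrightarrow> v \<in> C")
      case False
      then have "{u, v} \<notin> edges G"
        using C that unfolding separated_def by (metis DiffI insert_commute)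
      then show ?thesis using unit_flow_non_edge[OF f] by simp
    qed simp
    then have "(\<Sum>u\<in>?V. \<Sum>v\<in>?V. f u v * (?p u - ?p v)) = 0"
      by (intro sum.neutral ballI) auto
    then show False
      using unit_flow_potential[OF f _ s(1) t(1), of ?p] G s t by (simp add: weighted_graph_def)
  qed
  then show ?thesis by (rule eff_resistance_no_flow)
qed

text \<open>The edge alone carries a unit flow; its potential on \<open>{u, v}\<close> is the
  reciprocal conductance at \<open>u\<close> and 0 at \<open>v\<close>.\<close>

lemma eff_resistance_edge_finite:
  assumes H: "weighted_graph H" and e: "{u, v} \<in> edges H"
  shows "eff_resistance H u v < \<infinity>"
proof -
  define p where "p x = (if x = u then 1 / conductance H u v else 0)" for x
  have "u \<noteq> v" "u \<in> verts H" "v \<in> verts H"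
    using H e by (auto simp: weighted_graph_def)
  moreover have "conductance H u v \<noteq> 0"
    using e conductance_eq_0_iff[OF H] by blast
  ultimately have "eff_resistance H u v \<le> ereal (p u - p v)"
    using conductance_sym[of H u v]
    by (intro eff_resistance_le_potential[OF H, of "{u, v}"])
       (auto simp: p_def)
  then show ?thesis by (rule order_le_less_trans) simp
qed

text \<open>With \<open>L g\<^sub>x = e\<^sub>x - 1/k\<close>, the resistance of \<open>x, y\<close> is
  \<open>g\<^sub>x(x) - g\<^sub>x(y) + g\<^sub>y(y) - g\<^sub>y(x)\<close>, so by symmetry its conductance-weighted sum over ordered
  pairs is \<open>2 \<Sum>\<^sub>x (L g\<^sub>x)(x) = 2 (k - 1)\<close>.\<close>

lemma foster_le:
  assumes H: "weighted_graph H" and C: "C \<subseteq> verts H" and sep: "separated H C" "C \<noteq> {}"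
    and fin_res: "\<And>x y. \<lbrakk>x \<in> C; y \<in> C; x \<noteq> y\<rbrakk> \<Longrightarrow> eff_resistance H x y < \<infinity>"
    and ge: "\<And>x y. \<lbrakk>x \<in> C; y \<in> C; x \<noteq> y\<rbrakk> \<Longrightarrow> ereal r \<le> eff_resistance H x y"
  shows "r * (\<Sum>x\<in>C. \<Sum>y\<in>C. conductance H x y) \<le> 2 * (real (card C) - 1)"
proof -
  let ?W = "conductance H" and ?k = "real (card C)"
  have finV: "finite (verts H)" using H by (simp add: weighted_graph_def)
  from C this have fin: "finite C" by (rule finite_subset)
  have k: "?k > 0" using sep(2) fin by (simp add: card_gt_0_iff)
  \<comment> \<open>Finite resistance provides a unit flow from \<open>x\<close> to
    \<open>y\<close>. Extended by 0 outside \<open>C\<close>, \<open>g\<close> is constant along all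
    edges of \<open>H\<close>, so its pairing with the flow vanishes and equals
    \<open>g x - g y\<close>.\<close>
  have conn: "g x = (g y :: real)"
    if g: "\<forall>u\<in>C. \<forall>v\<in>C. ?W u v \<noteq> 0 \<longrightarrow> g u = g v" and xy: "x \<in> C" "y \<in> C" for g x y
  proof (cases "x = y")
    case False
    have "\<exists>f. unit_flow H x y f"
    proof (rule ccontr)
      assume "\<not> ?thesis"
      then have "eff_resistance H x y = \<infinity>"
        by (blast intro: eff_resistance_no_flow)
      with fin_res[OF xy False] show False by simp
    qed
    then obtain f where f: "unit_flow H x y f" by blast
    have "f u v * ((if u \<in> C then g u else 0) - (if v \<in> C then g v else 0)) = 0"
      if "u \<in> verts H" "v \<in> verts H" for u v
    proof (cases "{u, v} \<in> edges H")
      case True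
      then have "u \<in> C \<longleftrightarrow> v \<in> C"
        using sep(1) that unfolding separated_def by (metis DiffI insert_commute)
      moreover have "?W u v \<noteq> 0" using True conductance_eq_0_iff[OF H] by blast
      ultimately show ?thesis using g by auto
    next
      case False
      then show ?thesis using unit_flow_non_edge[OF f] by simp
    qed
    then have "(\<Sum>u\<in>verts H. \<Sum>v\<in>verts H.
        f u v * ((if u \<in> C then g u else 0) - (if v \<in> C then g v else 0))) = 0"
      by (intro sum.neutral ballI) auto
    with unit_flow_potential[OF f finV, of "\<lambda>u. if u \<in> C then g u else 0"] xy C
    show ?thesis by auto
  qed simp
  have sol: "\<forall>x\<in>C. \<exists>g. \<forall>v\<in>C. (\<Sum>u\<in>C. ?W v u * (g v - g u)) = of_bool (v = x) - 1 / ?k"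
  proof (rule ballI, rule laplacian_solvable[OF fin conductance_sym conductance_nonneg[OF H] conn])
    fix x assume "x \<in> C"
    then show "(\<Sum>v\<in>C. of_bool (v = x) - 1 / ?k) = 0"
      using fin k sep(2) by (simp add: sum_subtractf of_bool_def)
  qed
  obtain g where g: "\<And>x v. \<lbrakk>x \<in> C; v \<in> C\<rbrakk>
      \<Longrightarrow> (\<Sum>u\<in>C. ?W v u * (g x v - g x u)) = of_bool (v = x) - 1 / ?k"
    using bchoice[OF sol] by blast
  have res: "r \<le> (g x x - g x y) + (g y y - g y x)" if xy: "x \<in> C" "y \<in> C" "x \<noteq> y" for x y
  proof -
    let ?p = "\<lambda>v. g x v - g y v"
    have "eff_resistance H x y \<le> ereal (?p x - ?p y)"
    proof (rule eff_resistance_le_potential[OF H C xy(1,2)])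
      fix v assume v: "v \<in> C"
      have "(\<Sum>u\<in>C. ?W v u * (?p v - ?p u))
          = (\<Sum>u\<in>C. ?W v u * (g x v - g x u)) - (\<Sum>u\<in>C. ?W v u * (g y v - g y u))"
        by (simp add: sum_subtractf[symmetric] algebra_simps)
      then show "(\<Sum>u\<in>C. ?W v u * (?p v - ?p u)) = of_bool (v = x) - of_bool (v = y)"
        using g xy v by simp
    qed
    from order_trans[OF ge[OF xy] this] show ?thesis by simp
  qed
  have "r * (\<Sum>x\<in>C. \<Sum>y\<in>C. ?W x y) = (\<Sum>x\<in>C. \<Sum>y\<in>C. ?W x y * r)"
    by (simp add: sum_distrib_left mult.commute)
  also have "\<dots> \<le> (\<Sum>x\<in>C. \<Sum>y\<in>C. ?W x y * ((g x x - g x y) + (g y y - g y x)))"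
  proof (intro sum_mono)
    fix x y assume "x \<in> C" "y \<in> C"
    then show "?W x y * r \<le> ?W x y * ((g x x - g x y) + (g y y - g y x))"
      using res[of x y] conductance_nonneg[OF H, of x y] conductance_self[OF H, of x]
      by (cases "x = y") (auto intro: mult_left_mono)
  qed
  also have "\<dots> = (\<Sum>x\<in>C. \<Sum>y\<in>C. ?W x y * (g x x - g x y)) + (\<Sum>x\<in>C. \<Sum>y\<in>C. ?W x y * (g y y - g y x))"
    by (simp add: distrib_left sum.distrib)
  also have "(\<Sum>x\<in>C. \<Sum>y\<in>C. ?W x y * (g y y - g y x)) = (\<Sum>y\<in>C. \<Sum>x\<in>C. ?W x y * (g y y - g y x))"
    by (rule sum.swap)
  also have "\<dots> = (\<Sum>x\<in>C. \<Sum>y\<in>C. ?W x y * (g x x - g x y))"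
    by (intro sum.cong refl) (metis conductance_sym)
  also have "(\<Sum>x\<in>C. \<Sum>y\<in>C. ?W x y * (g x x - g x y)) = (\<Sum>x\<in>C. 1 - 1 / ?k)"
    by (intro sum.cong) (simp_all add: g)
  also have "\<dots> = ?k - 1"
    using k by (simp add: field_simps)
  finally show ?thesis by simp
qed

section \<open>Weights whose resistances are nearly those of a clique\<close>

lemma near_uniform_weights_nonzero:
  fixes W :: "'a \<Rightarrow> 'a \<Rightarrow> real"
  assumes fin: "finite C" and k: "k = real (card C)" "k \<ge> 2"
    and diag: "\<And>x. W x x = 0"
    and deg: "\<And>x y. \<lbrakk>x \<in> C; y \<in> C; x \<noteq> y\<rbrakk> \<Longrightarrow>
      4 \<le> (1 + \<epsilon>) * (2 / k) * (2 * W x y + (\<Sum>u\<in>C. W x u) + (\<Sum>u\<in>C. W y u))"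
    and total: "(1 - \<epsilon>) * (2 / k) * (\<Sum>x\<in>C. \<Sum>u\<in>C. W x u) \<le> 2 * (k - 1)"
    and \<epsilon>: "0 < \<epsilon>" "4 * k\<^sup>2 * \<epsilon> \<le> 1"
    and xy: "x \<in> C" "y \<in> C" "x \<noteq> y"
  shows "W x y \<noteq> 0"
proof
  assume W0: "W x y = 0"
  define d where "d x = (\<Sum>u\<in>C. W x u)" for x
  define D where "D = (\<Sum>x\<in>C. d x)"
  have "2\<^sup>2 \<le> k\<^sup>2" using k(2) by (intro power_mono) auto
  then have "4 * 4 * \<epsilon> \<le> 4 * k\<^sup>2 * \<epsilon>"
    using \<epsilon>(1) by (intro mult_right_mono mult_left_mono) auto
  with \<epsilon>(2) have \<epsilon>16: "\<epsilon> \<le> 1 / 16" by linarith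
  \<comment> \<open>Multiplying by \<open>1 - \<epsilon>\<close> replaces division by
    \<open>1 + \<epsilon>\<close>, because
    \<open>(1 + \<epsilon>) * (1 - \<epsilon>) \<le> 1\<close>.\<close>
  have low: "2 * k * (1 - \<epsilon>) \<le> 2 * W x y + d x + d y" (is "_ \<le> ?Z")
    if "x \<in> C" "y \<in> C" "x \<noteq> y" for x y
  proof -
    have Z: "2 * k \<le> (1 + \<epsilon>) * ?Z"
      using deg[OF that] k(2) unfolding d_def by (simp add: field_simps)
    then have "0 < (1 + \<epsilon>) * ?Z" using k(2) by linarith
    then have Z0: "?Z > 0" using \<epsilon>(1) by (simp add: zero_less_mult_iff)
    have "2 * k * (1 - \<epsilon>) \<le> ((1 + \<epsilon>) * ?Z) * (1 - \<epsilon>)"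
      using Z \<epsilon>16 by (intro mult_right_mono) auto
    also have "\<dots> = ?Z - \<epsilon>\<^sup>2 * ?Z"
      by (simp add: algebra_simps power2_eq_square)
    also have "\<dots> \<le> ?Z" using Z0 by simp
    finally show ?thesis .
  qed
  \<comment> \<open>Here \<open>1 + 2 * \<epsilon>\<close> replaces division by
    \<open>1 - \<epsilon>\<close>: the product
    \<open>(1 - \<epsilon>) * (1 + 2 * \<epsilon>)\<close> is at least 1 for
    \<open>\<epsilon> \<le> 1/2\<close>.\<close>
  have up: "D \<le> k * (k - 1) * (1 + 2 * \<epsilon>)"
  proof (cases "D \<ge> 0")
    case True
    have "(1 - \<epsilon>) * D \<le> k * (k - 1)"
      using total k(2) unfolding D_def d_def by (simp add: field_simps)
    then have "(1 - \<epsilon>) * D * (1 + 2 * \<epsilon>) \<le> k * (k - 1) * (1 + 2 * \<epsilon>)"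
      using \<epsilon>(1) by (intro mult_right_mono) auto
    moreover have "(1 - \<epsilon>) * D * (1 + 2 * \<epsilon>) = D + \<epsilon> * (1 - 2 * \<epsilon>) * D"
      by (simp add: algebra_simps)
    moreover have "\<epsilon> * (1 - 2 * \<epsilon>) * D \<ge> 0"
      using True \<epsilon>(1) \<epsilon>16 by simp
    ultimately show ?thesis by linarith
  next
    case False
    moreover have "0 \<le> k * (k - 1) * (1 + 2 * \<epsilon>)"
      using k(2) \<epsilon>(1) by simp
    ultimately show ?thesis by linarith
  qed
  \<comment> \<open>Summing \<open>low\<close> over the \<open>k - 1\<close> vertices other than
    \<open>x\<close> bounds \<open>2 * k * (k - 1) * (1 - \<epsilon>)\<close> by
    \<open>k * d x + D\<close>; then \<open>up\<close> removes \<open>D\<close>.\<close>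
  have dlow: "(k - 1) * (1 - 4 * \<epsilon>) \<le> d x" if x: "x \<in> C" for x
  proof -
    have card: "real (card (C - {x})) = k - 1"
      using fin x k by (simp add: card_Diff_singleton of_nat_diff)
    have "(k - 1) * (2 * k * (1 - \<epsilon>)) = (\<Sum>y\<in>C - {x}. 2 * k * (1 - \<epsilon>))"
      by (simp add: card)
    also have "\<dots> \<le> (\<Sum>y\<in>C - {x}. 2 * W x y + d x + d y)"
      using x by (intro sum_mono low) auto
    also have "\<dots> = 2 * (\<Sum>y\<in>C - {x}. W x y) + (k - 1) * d x + (\<Sum>y\<in>C - {x}. d y)"
      by (simp add: sum.distrib sum_distrib_left card)
    also have "(\<Sum>y\<in>C - {x}. W x y) = d x"
      using fin x diag by (simp add: sum_diff1 d_def)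
    also have "(\<Sum>y\<in>C - {x}. d y) = D - d x"
      using fin x by (simp add: sum_diff1 D_def)
    finally have "k * ((k - 1) * (1 - 4 * \<epsilon>)) \<le> k * d x"
      using up by (simp add: algebra_simps)
    then show ?thesis using k(2) by simp
  qed
  have card: "real (card (C - {x, y})) = k - 2"
    using fin xy k by (simp add: card_Diff_subset of_nat_diff)
  have "(k - 2) * ((k - 1) * (1 - 4 * \<epsilon>)) = (\<Sum>z\<in>C - {x, y}. (k - 1) * (1 - 4 * \<epsilon>))"
    by (simp add: card)
  also have "\<dots> \<le> (\<Sum>z\<in>C - {x, y}. d z)"
    by (intro sum_mono dlow) auto
  also have "\<dots> = D - (d x + d y)"
    using fin xy sum_diff[of C "{x, y}" d] by (simp add: D_def)
  finally have "2 * k * (1 - \<epsilon>) + (k - 2) * ((k - 1) * (1 - 4 * \<epsilon>)) \<le> k * (k - 1) * (1 + 2 * \<epsilon>)"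
    using low[OF xy] W0 up by linarith
  \<comment> \<open>The terms free of \<epsilon> differ by 2. On the right,
    \<open>6 * k^2 * \<epsilon>\<close> is at most \<open>3/2\<close> and
    \<open>8 * \<epsilon>\<close> is at most \<open>4 * k * \<epsilon>\<close>, which is a
    contradiction.\<close>
  then have "2 + 12 * (k * \<epsilon>) \<le> 6 * (k\<^sup>2 * \<epsilon>) + 8 * \<epsilon>"
    by (simp add: algebra_simps power2_eq_square)
  moreover have "2 * \<epsilon> \<le> k * \<epsilon>" using k(2) \<epsilon>(1) by simp
  ultimately show False using \<epsilon> by simp
qed

section \<open>Counting edges by degrees\<close>

text \<open>Double counting of incidences: each edge contains at most two vertices of
  \<open>S\<close>.\<close>

lemma card_edges_ge:
  assumes H: "weighted_graph H" and S: "S \<subseteq> verts H"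
    and deg: "\<And>v. v \<in> S \<Longrightarrow> m \<le> card {e \<in> edges H. v \<in> e}"
  shows "card S * m \<le> 2 * card (edges H)"
proof -
  have finV: "finite (verts H)" using H by (simp add: weighted_graph_def)
  have finS: "finite S" using S finV by (rule finite_subset)
  have "edges H \<subseteq> Pow (verts H)" using H by (auto simp: weighted_graph_def)
  then have finE: "finite (edges H)" using finV by (meson finite_Pow_iff finite_subset)
  have "card S * m = (\<Sum>v\<in>S. m)" by simp
  also have "\<dots> \<le> (\<Sum>v\<in>S. card {e \<in> edges H. v \<in> e})"
    by (intro sum_mono deg)
  also have "\<dots> = (\<Sum>v\<in>S. \<Sum>e | e \<in> edges H \<and> v \<in> e. 1)" by simp
  also have "\<dots> = (\<Sum>e\<in>edges H. \<Sum>v | v \<in> S \<and> v \<in> e. 1)"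
    by (rule sum.swap_restrict[OF finS finE])
  also have "\<dots> \<le> (\<Sum>e\<in>edges H. 2)"
  proof (rule sum_mono)
    fix e assume "e \<in> edges H"
    then have e: "card e = 2" using H by (simp add: weighted_graph_def)
    then have "card {v. v \<in> S \<and> v \<in> e} \<le> card e"
      by (intro card_mono) (auto intro: card_ge_0_finite)
    then show "(\<Sum>v | v \<in> S \<and> v \<in> e. 1) \<le> (2::nat)" using e by simp
  qed
  finally show ?thesis by simp
qed

section \<open>Disjoint unions of cliques\<close>

text \<open>The cliques are consecutive intervals of length \<open>k\<close>; the last one has only
  \<open>n mod k\<close> vertices when \<open>k\<close> does not divide \<open>n\<close>. The choice
  \<open>k = n\<close> gives the complete graph.\<close>

definition clique_blocks :: "nat \<Rightarrow> nat \<Rightarrow> nat wgraph" where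
  "clique_blocks n k = \<lparr>verts = {..<n},
     edges = {{u, v} | u v. u < n \<and> v < n \<and> u \<noteq> v \<and> u div k = v div k},
     weight = (\<lambda>_. 1)\<rparr>"

lemma verts_clique_blocks [simp]: "verts (clique_blocks n k) = {..<n}"
  by (simp add: clique_blocks_def)

lemma weighted_graph_clique_blocks: "weighted_graph (clique_blocks n k)"
  by (auto simp: clique_blocks_def weighted_graph_def)

lemma edges_clique_blocks_iff:
  "{u, v} \<in> edges (clique_blocks n k) \<longleftrightarrow> u < n \<and> v < n \<and> u \<noteq> v \<and> u div k = v div k"
  by (auto simp: clique_blocks_def doubleton_eq_iff)

lemma conductance_clique_blocks:
  "conductance (clique_blocks n k) u v = of_bool (u < n \<and> v < n \<and> u \<noteq> v \<and> u div k = v div k)"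
  unfolding conductance_def edges_clique_blocks_iff by (simp add: clique_blocks_def)

definition block :: "nat \<Rightarrow> nat \<Rightarrow> nat set" where
  "block k q = {q * k..<q * k + k}"

lemma mem_block_iff: "k > 0 \<Longrightarrow> u \<in> block k q \<longleftrightarrow> u div k = q"
proof -
  assume k: "k > 0"
  have "u div k = q \<longleftrightarrow> q \<le> u div k \<and> u div k < Suc q" by auto
  then show ?thesis
    using k by (auto simp: block_def less_eq_div_iff_mult_less_eq div_less_iff_less_mult)
qed

lemma finite_block [simp]: "finite (block k q)" and card_block [simp]: "card (block k q) = k"
  by (simp_all add: block_def)

lemma block_subset: "q < n div k \<Longrightarrow> block k q \<subseteq> {..<n}"
proof -
  assume "q < n div k"
  then have "(q + 1) * k \<le> (n div k) * k" by (intro mult_right_mono) auto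
  also have "\<dots> \<le> n" by simp
  finally show ?thesis by (auto simp: block_def)
qed

lemma separated_block: "k > 0 \<Longrightarrow> separated (clique_blocks n k) (block k q)"
  by (auto simp: separated_def edges_clique_blocks_iff mem_block_iff)

text \<open>Upper bound: the Laplacian of a clique on \<open>k\<close> vertices multiplies zero-sum
  vectors by \<open>k\<close>, so \<open>p\<close> is the potential of a unit flow. Lower bound:
  both degrees are \<open>k - 1\<close> and the joining edge has weight 1, so the degree bound
  applies with \<open>D = 2 * k\<close>.\<close>

lemma eff_resistance_block:
  assumes q: "q < n div k" and xy: "x \<in> block k q" "y \<in> block k q" "x \<noteq> y"
  shows "eff_resistance (clique_blocks n k) x y = ereal (2 / real k)"
proof (rule antisym)
  let ?G = "clique_blocks n k" and ?C = "block k q"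
  have k: "k > 0" using q by (cases k) auto
  have C: "?C \<subseteq> verts ?G" using block_subset[OF q] by simp
  have W: "conductance ?G u v = of_bool (u \<noteq> v)" if "u \<in> ?C" "v \<in> ?C" for u v
    using that C k by (auto simp: conductance_clique_blocks mem_block_iff)
  define p :: "nat \<Rightarrow> real" where "p v = (of_bool (v = x) - of_bool (v = y)) / k" for v
  have sum_p: "(\<Sum>u\<in>?C. p u) = 0"
    using xy by (simp add: p_def sum_divide_distrib[symmetric] sum_subtractf of_bool_def)
  have "eff_resistance ?G x y \<le> ereal (p x - p y)"
  proof (rule eff_resistance_le_potential[OF weighted_graph_clique_blocks C xy(1,2)])
    fix v assume v: "v \<in> ?C"
    have "(\<Sum>u\<in>?C. conductance ?G v u * (p v - p u)) = (\<Sum>u\<in>?C. p v - p u)"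
      using v by (intro sum.cong) (auto simp: W)
    also have "\<dots> = k * p v"
      by (simp add: sum_subtractf sum_p)
    finally show "(\<Sum>u\<in>?C. conductance ?G v u * (p v - p u)) = of_bool (v = x) - of_bool (v = y)"
      using k by (simp add: p_def)
  qed
  also have "p x - p y = 2 / k" using xy(3) by (simp add: p_def)
  finally show le: "eff_resistance ?G x y \<le> ereal (2 / k)" .
  have row: "(\<Sum>v\<in>verts ?G. conductance ?G u v) = real k - 1" if u: "u \<in> ?C" for u
  proof -
    have "(\<Sum>v\<in>verts ?G. conductance ?G u v) = (\<Sum>v\<in>?C - {u}. 1)"
      using C u k by (intro sum.mono_neutral_cong_right)
        (auto simp: conductance_clique_blocks mem_block_iff)
    then show ?thesis using u k by (simp add: of_nat_diff card_Diff_singleton)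
  qed
  have ge: "4 \<le> r * (2 * k)" if "eff_resistance ?G x y \<le> ereal r" for r
    using eff_resistance_ge_degrees[OF weighted_graph_clique_blocks _ _ xy(3) refl that] xy C
    by (simp add: row[simplified] W subset_iff algebra_simps)
  show "ereal (2 / k) \<le> eff_resistance ?G x y"
  proof (cases "eff_resistance ?G x y")
    case (real r)
    then show ?thesis using ge[of r] k by (simp add: field_simps)
  next
    case MInf
    then show ?thesis using ge[of 0] by simp
  qed simp
qed

section \<open>Edges of sparsifiers\<close>

lemma sparsifier_clique_block:
  assumes H: "resistance_sparsifier \<epsilon> (clique_blocks n k) H"
    and q: "q < n div k" and k: "k \<ge> 2" and \<epsilon>: "0 < \<epsilon>" "4 * (real k)\<^sup>2 * \<epsilon> \<le> 1"
    and xy: "x \<in> block k q" "y \<in> block k q" "x \<noteq> y"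
  shows "{x, y} \<in> edges H"
proof -
  let ?G = "clique_blocks n k" and ?C = "block k q"
  have wH: "weighted_graph H" and vH: "verts H = {..<n}"
    and R: "\<And>x y. \<lbrakk>x < n; y < n\<rbrakk> \<Longrightarrow>
        ereal (1 - \<epsilon>) * eff_resistance ?G x y \<le> eff_resistance H x y \<and>
        eff_resistance H x y \<le> ereal (1 + \<epsilon>) * eff_resistance ?G x y"
    using H by (auto simp: resistance_sparsifier_def)
  have C: "?C \<subseteq> {..<n}" by (rule block_subset[OF q])
  have "2\<^sup>2 \<le> (real k)\<^sup>2" using k by (intro power_mono) auto
  then have "4 * 4 * \<epsilon> \<le> 4 * (real k)\<^sup>2 * \<epsilon>"
    using \<epsilon>(1) by (intro mult_right_mono mult_left_mono) auto
  with \<epsilon>(2) have \<epsilon>1: "\<epsilon> < 1" by linarith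
  \<comment> \<open>Because \<open>\<epsilon> < 1\<close>, the lower bound stays infinite between
    different components, so no edge of \<open>H\<close> leaves the block. Degrees in
    \<open>H\<close> are therefore sums over the block alone.\<close>
  have sep: "separated H ?C"
    unfolding separated_def
  proof (intro ballI notI)
    fix u v assume u: "u \<in> ?C" and v: "v \<in> verts H - ?C" and e: "{u, v} \<in> edges H"
    have "eff_resistance ?G u v = \<infinity>"
      using u v C vH k
      by (intro eff_resistance_separated[OF weighted_graph_clique_blocks separated_block]) auto
    then have "eff_resistance H u v = \<infinity>"
      using R[of u v] u v C vH \<epsilon>1 by auto
    with eff_resistance_edge_finite[OF wH e] show False by simp
  qed
  have res: "ereal ((1 - \<epsilon>) * (2 / k)) \<le> eff_resistance H x y"
    "eff_resistance H x y \<le> ereal ((1 + \<epsilon>) * (2 / k))"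
    if "x \<in> ?C" "y \<in> ?C" "x \<noteq> y" for x y
    using R[of x y] eff_resistance_block[OF q that] that C by auto
  have row: "(\<Sum>v\<in>verts H. conductance H u v) = (\<Sum>v\<in>?C. conductance H u v)" if "u \<in> ?C" for u
    using sep that C vH by (intro sum.mono_neutral_right) (auto simp: separated_def conductance_def)
  have "conductance H x y \<noteq> 0"
  proof (rule near_uniform_weights_nonzero[OF finite_block _ _ conductance_self[OF wH] _ _ \<epsilon> xy])
    show "real k = real (card ?C)" "2 \<le> real k" using k by simp_all
    show "4 \<le> (1 + \<epsilon>) * (2 / real k) * (2 * conductance H x y
          + (\<Sum>u\<in>?C. conductance H x u) + (\<Sum>u\<in>?C. conductance H y u))"
      if "x \<in> ?C" "y \<in> ?C" "x \<noteq> y" for x y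
      using eff_resistance_ge_degrees[OF wH _ _ that(3) refl res(2)[OF that]] that C vH row
      by auto
    have "?C \<noteq> {}" using xy by auto
    moreover have "eff_resistance H x y < \<infinity>" if "x \<in> ?C" "y \<in> ?C" "x \<noteq> y" for x y
      using res(2)[OF that] by (rule order_le_less_trans) simp
    ultimately show "(1 - \<epsilon>) * (2 / real k) * (\<Sum>x\<in>?C. \<Sum>u\<in>?C. conductance H x u) \<le> 2 * (real k - 1)"
      using foster_le[OF wH _ sep _ _ res(1)] C vH by simp
  qed
  then show ?thesis using conductance_eq_0_iff[OF wH] by blast
qed

text \<open>Each vertex of a full block keeps its \<open>k - 1\<close> neighbours in
  \<open>H\<close>. Full blocks cover at least half of the vertices and
  \<open>k - 1 \<ge> k / 2\<close>; halving the degree sum gives the factor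
  \<open>1/8\<close>.\<close>

lemma sparsifier_small_error:
  assumes H: "resistance_sparsifier \<epsilon> (clique_blocks n k) H"
    and k: "2 \<le> k" "k \<le> n" and \<epsilon>: "0 < \<epsilon>" "4 * (real k)\<^sup>2 * \<epsilon> \<le> 1"
  shows "real (card (edges H)) \<ge> real n * real k / 8"
proof -
  have wH: "weighted_graph H" and vH: "verts H = {..<n}"
    using H by (auto simp: resistance_sparsifier_def)
  have "edges H \<subseteq> Pow (verts H)" using wH by (auto simp: weighted_graph_def)
  then have finE: "finite (edges H)" using vH by (simp add: finite_subset)
  have m: "n div k * k \<le> n" by simp
  have "card {..<n div k * k} * (k - 1) \<le> 2 * card (edges H)"
  proof (rule card_edges_ge[OF wH])
    show "{..<n div k * k} \<subseteq> verts H" using m vH by auto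
    fix v assume v: "v \<in> {..<n div k * k}"
    define q where "q = v div k"
    have q: "q < n div k" using v by (simp add: q_def less_mult_imp_div_less)
    have vq: "v \<in> block k q" using k by (simp add: mem_block_iff q_def)
    have "k - 1 = card (block k q - {v})" using vq by (simp add: card_Diff_singleton)
    also have "\<dots> = card ((\<lambda>u. {v, u}) ` (block k q - {v}))"
      by (rule card_image[symmetric]) (auto simp: inj_on_def doubleton_eq_iff)
    also have "\<dots> \<le> card {e \<in> edges H. v \<in> e}"
      using sparsifier_clique_block[OF H q k(1) \<epsilon> vq] finE by (intro card_mono) auto
    finally show "k - 1 \<le> card {e \<in> edges H. v \<in> e}" .
  qed
  then have "real (n div k * k * (k - 1)) \<le> real (2 * card (edges H))"
    by (simp only: of_nat_le_iff card_lessThan)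
  then have E: "real (n div k * k) * (real k - 1) \<le> 2 * real (card (edges H))"
    using k by (simp add: of_nat_diff)
  \<comment> \<open>There is at least one full block, so the remainder \<open>n mod k\<close> is
    smaller than the part covered by full blocks.\<close>
  have "1 \<le> n div k" using k by (simp add: div_greater_zero_iff Suc_leI)
  then have "k \<le> n div k * k" by simp
  moreover have "n = n div k * k + n mod k" "n mod k < k" using k by simp_all
  ultimately have "n \<le> 2 * (n div k * k)" by linarith
  then have "real n \<le> real (2 * (n div k * k))" by (simp only: of_nat_le_iff)
  then have "real n / 2 \<le> real (n div k * k)" by simp
  then have "real n / 2 * (real k / 2) \<le> real (n div k * k) * (real k - 1)"
    using k by (intro mult_mono) auto
  with E show ?thesis by simp
qed

text \<open>The upper bound on resistances in \<open>H\<close> is finite, so a unit flow leaves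
  every vertex and each vertex meets an edge.\<close>

lemma sparsifier_complete_graph:
  assumes H: "resistance_sparsifier \<epsilon> (clique_blocks n n) H" and n: "n \<ge> 2"
  shows "real (card (edges H)) \<ge> real n / 2"
proof -
  have wH: "weighted_graph H" and vH: "verts H = {..<n}"
    using H by (auto simp: resistance_sparsifier_def)
  have "edges H \<subseteq> Pow (verts H)" using wH by (auto simp: weighted_graph_def)
  then have finE: "finite (edges H)" using vH by (simp add: finite_subset)
  have "card {..<n} * 1 \<le> 2 * card (edges H)"
  proof (rule card_edges_ge[OF wH])
    fix v assume "v \<in> {..<n}"
    then have v: "v < n" by simp
    define u where "u = (if v = 0 then 1 else 0 :: nat)"
    have u: "u < n" "v \<noteq> u" using n by (auto simp: u_def)
    have "eff_resistance H v u \<le> ereal (1 + \<epsilon>) * eff_resistance (clique_blocks n n) v u"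
      using H v u by (auto simp: resistance_sparsifier_def)
    also have "eff_resistance (clique_blocks n n) v u = ereal (2 / n)"
      using u v n by (intro eff_resistance_block[of 0]) (auto simp: block_def)
    finally have "eff_resistance H v u \<noteq> \<infinity>" by auto
    then obtain f where f: "unit_flow H v u f"
      using eff_resistance_no_flow by metis
    have "v \<in> verts H" using v vH by simp
    then have "(\<Sum>w\<in>verts H. f v w) = of_bool (v = v) - of_bool (v = u)"
      using f unfolding unit_flow_def by blast
    then have "(\<Sum>w\<in>verts H. f v w) = 1" using u(2) by simp
    then obtain w where "f v w \<noteq> 0" by (metis sum.neutral zero_neq_one)
    then have "{v, w} \<in> {e \<in> edges H. v \<in> e}" using unit_flow_non_edge[OF f] by blast
    then have "card {e \<in> edges H. v \<in> e} > 0" using finE by (auto simp: card_gt_0_iff)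
    then show "1 \<le> card {e \<in> edges H. v \<in> e}" by simp
  qed (simp add: vH)
  then show ?thesis by simp
qed

theorem theorem3p6:
  "\<exists>c::real. c > 0 \<and>
     (\<forall>n::nat. n \<ge> 2 \<longrightarrow>
       (\<forall>\<epsilon>::real. \<epsilon> > 1 / real n \<longrightarrow>
         (\<exists>G :: nat wgraph. weighted_graph G \<and> card (verts G) = n \<and>
           (\<forall>H :: nat wgraph. resistance_sparsifier \<epsilon> G H \<longrightarrow>
              real (card (edges H)) \<ge> c * real n / sqrt \<epsilon>))))"
\<comment> \<open>The constant comes from small \<epsilon>: the bound \<open>n * k / 8\<close> with
  \<open>k \<ge> t / 2\<close> and \<open>t = 1 / (2 * sqrt \<epsilon>)\<close>.\<close>
proof (rule exI[of _ "1 / 32"], intro conjI allI impI)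
  fix n :: nat and \<epsilon> :: real assume n: "2 \<le> n" and \<epsilon>n: "1 / real n < \<epsilon>"
  have \<epsilon>0: "\<epsilon> > 0" by (rule le_less_trans[OF _ \<epsilon>n]) simp
  have "\<exists>k. \<forall>H. resistance_sparsifier \<epsilon> (clique_blocks n k) H \<longrightarrow>
              real (card (edges H)) \<ge> 1 / 32 * real n / sqrt \<epsilon>"
  proof (cases "\<epsilon> > 1 / 16")
    case True
    then have "sqrt (1 / 16) \<le> sqrt \<epsilon>" by (intro real_sqrt_le_mono) simp
    then have s: "1 / 4 \<le> sqrt \<epsilon>" by (simp add: real_sqrt_divide)
    have "1 / 32 * real n / sqrt \<epsilon> \<le> 1 / 32 * real n / (1 / 4)"
      using s \<epsilon>0 by (intro divide_left_mono) auto
    also have "\<dots> \<le> real n / 2" by simp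
    finally show ?thesis
      using order_trans[OF _ sparsifier_complete_graph[OF _ n]] by blast
  next
    case False
    \<comment> \<open>This is the largest real clique size with
      \<open>4 * t^2 * \<epsilon> \<le> 1\<close>; \<open>\<epsilon> \<le> 1/16\<close> makes it at
      least 2, so rounding down loses at most a factor 2.\<close>
    define t where "t = 1 / (2 * sqrt \<epsilon>)"
    define k where "k = nat \<lfloor>t\<rfloor>"
    have s: "sqrt \<epsilon> > 0" using \<epsilon>0 by simp
    have "sqrt \<epsilon> \<le> sqrt (1 / 16)" using False by (intro real_sqrt_le_mono) simp
    then have "sqrt \<epsilon> \<le> 1 / 4" by (simp add: real_sqrt_divide)
    then have t2: "t \<ge> 2" using s by (simp add: t_def field_simps)
    have t_sq: "4 * t\<^sup>2 * \<epsilon> = 1" using \<epsilon>0 by (simp add: t_def power_divide power_mult_distrib)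
    have kt: "real k \<le> t" "t - 1 < real k" using t2 unfolding k_def by linarith+
    have k2: "k \<ge> 2" using t2 unfolding k_def by linarith
    have "4 * (real k)\<^sup>2 * \<epsilon> \<le> 4 * t\<^sup>2 * \<epsilon>"
      using kt \<epsilon>0 by (intro mult_right_mono mult_left_mono power_mono) auto
    then have k\<epsilon>: "4 * (real k)\<^sup>2 * \<epsilon> \<le> 1" using t_sq by simp
    \<comment> \<open>The assumption \<open>\<epsilon> > 1 / n\<close> ensures that a clique of size
      \<open>k\<close> fits: \<open>k * \<epsilon> \<le> 1 < n * \<epsilon>\<close>.\<close>
    have "real k * 1 \<le> real k * real k" using k2 by (intro mult_left_mono) auto
    then have "real k * \<epsilon> \<le> (real k)\<^sup>2 * \<epsilon>"
      unfolding power2_eq_square using \<epsilon>0 by (intro mult_right_mono) auto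
    moreover have "0 \<le> (real k)\<^sup>2 * \<epsilon>" using \<epsilon>0 by simp
    ultimately have "real k * \<epsilon> \<le> 1" using k\<epsilon> by linarith
    moreover have "1 < real n * \<epsilon>" using \<epsilon>n n by (simp add: field_simps)
    ultimately have "real k * \<epsilon> < real n * \<epsilon>" by linarith
    then have kn: "k \<le> n" using \<epsilon>0 by simp
    have "1 / 32 * real n / sqrt \<epsilon> = real n * (t / 2) / 8" by (simp add: t_def)
    also have "\<dots> \<le> real n * real k / 8"
      using kt t2 by (intro divide_right_mono mult_left_mono) auto
    finally show ?thesis
      using order_trans[OF _ sparsifier_small_error[OF _ k2 kn \<epsilon>0 k\<epsilon>]] by blast
  qed
  then show "\<exists>G :: nat wgraph. weighted_graph G \<and> card (verts G) = n \<and>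
           (\<forall>H :: nat wgraph. resistance_sparsifier \<epsilon> G H \<longrightarrow>
              real (card (edges H)) \<ge> 1 / 32 * real n / sqrt \<epsilon>)"
    using weighted_graph_clique_blocks verts_clique_blocks card_lessThan by metis
qed simp

end
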